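(* Let $P$ be a poset. There is no assignment of a strict upper bound to each chain in $P$; that is, there is no function $f$ from the set of all chains of $P$ to $P$ such that for every chain $C \subseteq P$, $f(C)$ is a strict upper bound of $C$.
   Context: A chain in a poset $P$ is a linearly ordered subset of $P$ (the empty set is a chain). For $C \subseteq P$, an element $s \in P$ is a strict upper bound of $C$ if $c < s$ for all $c \in C$. *)

theory Defs
  imports Main "HOL-Library.FuncSet"
begin

text \<open>
  A poset is a carrier set \<open>P\<close> (possibly empty) with a reflexive order relation \<open>r\<close>
  such that \<open>partial_order_on P r\<close>, which includes \<open>r \<subseteq> P \<times> P\<close>. The library notions
  \<open>Chains r\<close> and \<open>AboveS r C\<close> mention only \<open>r\<close>; the following two facts spell out that
  over such a poset they are the linearly ordered subsets of \<open>P\<close> and the strict upper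
  bounds in \<open>P\<close>.
\<close>

lemma Chains_iff_linear_order_on:
  assumes "partial_order_on P r"
  shows "C \<in> Chains r \<longleftrightarrow> C \<subseteq> P \<and> linear_order_on C (r \<inter> C \<times> C)"
proof
  assume C: "C \<in> Chains r"
  then have "C \<subseteq> P"
    using assms by (auto simp: Chains_def order_on_defs)
  moreover have "refl_on C (r \<inter> C \<times> C)"
    using C by (auto simp: Chains_def refl_on_def)
  moreover have "total_on C (r \<inter> C \<times> C)"
    using C by (auto simp: Chains_def total_on_def)
  moreover have "trans (r \<inter> C \<times> C)"
    using assms unfolding order_on_defs
    by (intro transI) (auto dest: transD)
  moreover have "antisym (r \<inter> C \<times> C)"
    using assms unfolding order_on_defs
    by (intro antisymI) (auto dest: antisymD)
  ultimately show "C \<subseteq> P \<and> linear_order_on C (r \<inter> C \<times> C)"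
    by (simp add: order_on_defs)
next
  assume "C \<subseteq> P \<and> linear_order_on C (r \<inter> C \<times> C)"
  then have "refl_on C (r \<inter> C \<times> C)" and "total_on C (r \<inter> C \<times> C)"
    by (simp_all add: order_on_defs)
  then show "C \<in> Chains r"
    unfolding Chains_def refl_on_def total_on_def by (clarsimp) (metis IntD1)
qed

lemma AboveS_iff_strict_upper_bound:
  assumes "partial_order_on P r"
  shows "s \<in> AboveS r C \<longleftrightarrow> s \<in> P \<and> (\<forall>c\<in>C. (c, s) \<in> r \<and> c \<noteq> s)"
proof -
  have "Field r = P"
    using assms unfolding order_on_defs refl_on_def Field_def by blast
  then show ?thesis
    unfolding AboveS_def by blast
qed

end

theory Submission
  imports Defs "HOL-Library.Bourbaki_Witt_Fixpoint"
begin

text \<open>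
  Suppose \<open>f\<close> assigns a strict upper bound to each chain. Then adding \<open>f C\<close> to a chain \<open>C\<close>
  yields a strictly larger chain, since \<open>f C\<close> lies above every element of \<open>C\<close> and is not in \<open>C\<close>.
  Iterating \<open>C \<mapsto> C \<union> {f C}\<close> transfinitely from the empty chain, with unions at limit stages,
  would never stop. The Bourbaki--Witt theorem says that it must: the chains, ordered by
  inclusion, are closed under unions of nested families, and every inflationary map on such an
  order has a fixed point.

  Since \<open>f\<close> supplies the new element at each successor stage and unions settle the limit stages,
  the iteration itself makes no choices. Iterating inside the order of chains, rather than in \<open>P\<close>,
  provides the suprema that \<open>P\<close> may lack.
\<close>

text \<open>
  This is the Bourbaki--Witt theorem for families of sets: inclusion is a partial order in which
  a union that belongs to the family is automatically the least upper bound.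
\<close>

lemma inflationary_map_on_sets_has_fixed_point:
  fixes \<A> :: "'a set set" and g :: "'a set \<Rightarrow> 'a set"
  assumes start: "A \<in> \<A>"
    and Union_closed: "\<And>\<C>. \<C> \<subseteq> \<A> \<Longrightarrow> \<C> \<noteq> {} \<Longrightarrow> chain\<^sub>\<subseteq> \<C> \<Longrightarrow> \<Union>\<C> \<in> \<A>"
    and closed: "\<And>X. X \<in> \<A> \<Longrightarrow> g X \<in> \<A>"
    and inflationary: "\<And>X. X \<in> \<A> \<Longrightarrow> X \<subseteq> g X"
  obtains X where "X \<in> \<A>" and "g X = X"
proof -
  let ?incl = "relation_of (\<subseteq>) \<A>"
  have Field: "Field ?incl = \<A>"
    by (auto simp: relation_of_def Field_def)
  have nested: "\<C> \<subseteq> \<A> \<and> chain\<^sub>\<subseteq> \<C>" if "\<C> \<in> Chains ?incl" for \<C>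
    using that by (auto simp: Chains_def relation_of_def chain_subset_def)
  have Union_in: "\<Union>\<C> \<in> \<A>" if "\<C> \<in> Chains ?incl" "\<C> \<noteq> {}" for \<C>
    using that nested Union_closed by blast
  interpret bourbaki_witt_fixpoint Union ?incl g
  proof
    show "Partial_order ?incl"
      unfolding Field by (rule partial_order_on_relation_ofI) auto
  next
    fix \<C> Z
    assume "\<C> \<in> Chains ?incl" "\<C> \<noteq> {}" and "\<And>X. X \<in> \<C> \<Longrightarrow> (X, Z) \<in> ?incl"
    then show "(\<Union>\<C>, Z) \<in> ?incl"
      using Union_in[of \<C>] unfolding relation_of_def by blast
  next
    fix \<C> X
    assume "\<C> \<in> Chains ?incl" "X \<in> \<C>"
    then show "(X, \<Union>\<C>) \<in> ?incl"
      using Union_in[of \<C>] nested[of \<C>] unfolding relation_of_def by blast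
  next
    fix \<C>
    assume "\<C> \<in> Chains ?incl" "\<C> \<noteq> {}"
    then show "\<Union>\<C> \<in> Field ?incl"
      unfolding Field by (rule Union_in)
  next
    fix X
    assume "X \<in> Field ?incl"
    then show "(X, g X) \<in> ?incl"
      unfolding Field using closed inflationary by (simp add: relation_of_def)
  qed
  have "A \<in> Field ?incl"
    unfolding Field by (rule start)
  then have "fixp_above A \<in> \<A>" and "g (fixp_above A) = fixp_above A"
    using fixp_above_Field fixp_above_unfold[symmetric] unfolding Field by blast+
  then show thesis
    by (rule that)
qed

text \<open>Any two elements of the union lie together in the larger of two nested members.\<close>

lemma Union_nested_Chains:
  assumes "\<C> \<subseteq> Chains r" and "chain\<^sub>\<subseteq> \<C>"
  shows "\<Union>\<C> \<in> Chains r"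
proof (rule ChainsI)
  fix a b
  assume "a \<in> \<Union>\<C>" "b \<in> \<Union>\<C>"
  then obtain C where "C \<in> \<C>" "a \<in> C" "b \<in> C"
    using assms(2) unfolding chain_subset_def by blast
  then show "(a, b) \<in> r \<or> (b, a) \<in> r"
    using assms(1) by (blast dest: in_ChainsD)
qed

lemma insert_AboveS_Chains:
  assumes "partial_order_on P r" and "C \<in> Chains r" and "s \<in> AboveS r C"
  shows "insert s C \<in> Chains r"
proof -
  have "s \<in> P" and above: "\<And>c. c \<in> C \<Longrightarrow> (c, s) \<in> r"
    using assms(1,3) by (auto simp: AboveS_iff_strict_upper_bound)
  then have "(s, s) \<in> r"
    using assms(1) by (auto simp: order_on_defs refl_on_def)
  then show ?thesis
    using assms(2) above by (auto simp: Chains_def)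
qed

theorem lemma5:
  fixes P :: "'a set" and r :: "'a rel"
  assumes "partial_order_on P r"
  shows "\<not> (\<exists>f. f \<in> Chains r \<rightarrow> P \<and> (\<forall>C \<in> Chains r. f C \<in> AboveS r C))"
proof
  assume "\<exists>f. f \<in> Chains r \<rightarrow> P \<and> (\<forall>C \<in> Chains r. f C \<in> AboveS r C)"
  then obtain f where f: "\<And>C. C \<in> Chains r \<Longrightarrow> f C \<in> AboveS r C"
    by blast
  have "{} \<in> Chains r"
    by (simp add: Chains_def)
  then obtain C where C: "C \<in> Chains r" and fixed: "insert (f C) C = C"
  proof (rule inflationary_map_on_sets_has_fixed_point[where g = "\<lambda>C. insert (f C) C"])
    show "\<Union>\<C> \<in> Chains r" if "\<C> \<subseteq> Chains r" "chain\<^sub>\<subseteq> \<C>" for \<C>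
      using that by (rule Union_nested_Chains)
    show "insert (f C) C \<in> Chains r" if "C \<in> Chains r" for C
      using assms that f[OF that] by (rule insert_AboveS_Chains)
  qed auto
  have "f C \<in> C"
    using fixed by blast
  moreover have "f C \<notin> C"
    using f[OF C] by (auto simp: AboveS_def)
  ultimately show False
    by contradiction
qed

end
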